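(* Let $G$ be a finitely generated metabelian group with a nontrivial element $x\in\mathrm{Fitt}(G)$ that is strictly exponentially distorted. Then $n\preceq\mathrm{RF}_G(n)$. In particular, $n\preceq\mathrm{RF}_{\mathrm{BS}(1,m)}(n)$ for every integer $m>1$.
   Context: $\mathrm{BS}(k,m)=\langle x,t \mid t x^k t^{-1}=x^m\rangle$ is the Baumslag-Solitar group. $\mathrm{Fitt}(G)$, the Fitting subgroup, is the subgroup generated by all normal nilpotent subgroups of $G$. $\mathbb{N}$ denotes the positive integers. For a finitely generated group $G$ with finite generating subset $S$, $\|x\|_S$ is the word length of $x$. An infinite order element $x\in G$ is strictly exponentially distorted if there are constants $C_1,C_2>0$ with $C_1|n|\le 2^{\|x^n\|_S}\le C_2|n|$ for all integers $n>0$. For a finitely generated, residually finite group $G$ (finitely generated metabelian groups are residually finite by a theorem of P. Hall) and $x\in G\setminus\{1\}$ let $\mathrm{D}_G(x)=\min\{|H| : \varphi:G\to H \text{ a surjective homomorphism},\ |H|<\infty,\ \varphi(x)\ne 1\}$, and $\mathrm{RF}_{G}(n)=\mathrm{RF}_{G,S}(n)=\max\{\mathrm{D}_G(x) : \|x\|_S\le n,\ x\ne 1\}$. For nondecreasing functions $f,g$ on $\mathbb{N}$, $f\preceq g$ means that there is a constant $C>0$ (which may be taken to be an integer) with $f(n)\le C\,g(Cn)$ for all $n$; the choice of $S$ does not affect $\mathrm{RF}_G$ up to this relation in both directions. *)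

theory Defs
  imports
    Complex_Main
    "HOL-Algebra.Algebra"
    "HOL-Library.Extended_Nat"
begin

section \<open>Word length and distortion\<close>

definition finitely_generates :: "('a, 'b) monoid_scheme \<Rightarrow> 'a set \<Rightarrow> bool" where
  "finitely_generates G S \<longleftrightarrow> finite S \<and> S \<subseteq> carrier G \<and> generate G S = carrier G"

definition word_length :: "('a, 'b) monoid_scheme \<Rightarrow> 'a set \<Rightarrow> 'a \<Rightarrow> nat" where
  "word_length G S x = (LEAST n. \<exists>ws. length ws = n \<and> set ws \<subseteq> S \<union> m_inv G ` S \<and>
      foldr (\<lambda>a b. a \<otimes>\<^bsub>G\<^esub> b) ws \<one>\<^bsub>G\<^esub> = x)"

text \<open>In HOL-Algebra \<open>ord x = 0\<close> says that \<open>x\<close> has infinite order.\<close>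

definition strictly_exp_distorted ::
    "('a, 'b) monoid_scheme \<Rightarrow> 'a set \<Rightarrow> 'a \<Rightarrow> bool" where
  "strictly_exp_distorted G S x \<longleftrightarrow> x \<in> carrier G \<and> group.ord G x = 0 \<and>
     (\<exists>C1 C2 :: real. C1 > 0 \<and> C2 > 0 \<and>
       (\<forall>n::nat. n > 0 \<longrightarrow>
          C1 * real n \<le> 2 ^ word_length G S (x [^]\<^bsub>G\<^esub> n) \<and>
          2 ^ word_length G S (x [^]\<^bsub>G\<^esub> n) \<le> C2 * real n))"


section \<open>Metabelian groups and the Fitting subgroup\<close>

definition metabelian :: "('a, 'b) monoid_scheme \<Rightarrow> bool" where
  "metabelian G \<longleftrightarrow> group G \<and> comm_group (G\<lparr>carrier := derived G (carrier G)\<rparr>)"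

primrec lower_central :: "('a, 'b) monoid_scheme \<Rightarrow> nat \<Rightarrow> 'a set" where
  "lower_central G 0 = carrier G"
| "lower_central G (Suc n) = generate G
     {a \<otimes>\<^bsub>G\<^esub> b \<otimes>\<^bsub>G\<^esub> inv\<^bsub>G\<^esub> a \<otimes>\<^bsub>G\<^esub> inv\<^bsub>G\<^esub> b | a b. a \<in> lower_central G n \<and> b \<in> carrier G}"

definition nilpotent_group :: "('a, 'b) monoid_scheme \<Rightarrow> bool" where
  "nilpotent_group G \<longleftrightarrow> group G \<and> (\<exists>c. lower_central G c = {\<one>\<^bsub>G\<^esub>})"

definition Fitt :: "('a, 'b) monoid_scheme \<Rightarrow> 'a set" where
  "Fitt G = generate G (\<Union>{N. N \<lhd> G \<and> nilpotent_group (G\<lparr>carrier := N\<rparr>)})"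


section \<open>Residual finiteness growth\<close>

text \<open>
  Every finite group is isomorphic to one whose elements are natural numbers, so letting the
  target \<open>H\<close> range over groups on the type \<^typ>\<open>nat\<close> loses no quotient.

  The values are extended naturals, with \<open>\<infinity>\<close> if no finite quotient detects \<open>x\<close>.
  If \<open>G\<close> is residually finite and \<open>x\<close> is not the identity, the set is nonempty and the infimum
  is a minimum; if moreover \<open>G\<close> is finitely generated, the supremum in \<open>RF\<close> is taken over a finite
  set of finite values, hence is a maximum (\<open>0\<close> if the set is empty).
\<close>

definition detect_order :: "('a, 'b) monoid_scheme \<Rightarrow> 'a \<Rightarrow> enat" where
  "detect_order G x = Inf {enat (order H) | (H :: nat monoid) \<phi>.
     group H \<and> finite (carrier H) \<and> \<phi> \<in> epi G H \<and> \<phi> x \<noteq> \<one>\<^bsub>H\<^esub>}"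

definition RF :: "('a, 'b) monoid_scheme \<Rightarrow> 'a set \<Rightarrow> nat \<Rightarrow> enat" where
  "RF G S n = Sup {detect_order G x | x. x \<in> carrier G \<and> x \<noteq> \<one>\<^bsub>G\<^esub> \<and> word_length G S x \<le> n}"

text \<open>Functions on the positive integers: the value at \<open>0\<close> plays no role.\<close>

definition growth_le :: "(nat \<Rightarrow> enat) \<Rightarrow> (nat \<Rightarrow> enat) \<Rightarrow> bool" where
  "growth_le f g \<longleftrightarrow> (\<exists>C::nat. C > 0 \<and> (\<forall>n::nat. n > 0 \<longrightarrow> f n \<le> enat C * g (C * n)))"


section \<open>Group presentations\<close>

text \<open>
  A word over generators of type \<open>'g\<close> is a list of letters; \<open>(g, True)\<close> stands for \<open>g\<close> and
  \<open>(g, False)\<close> for its formal inverse. A relation \<open>u = v\<close> is a pair of words. The group presented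
  by \<open>R\<close> (generated by all of \<open>'g\<close>) consists of the classes of words modulo the least congruence
  that contains \<open>R\<close> and the free cancellations.
\<close>

type_synonym 'g word = "('g \<times> bool) list"

inductive pres_eq :: "('g word \<times> 'g word) set \<Rightarrow> 'g word \<Rightarrow> 'g word \<Rightarrow> bool"
  for R where
    refl: "pres_eq R u u"
  | sym: "pres_eq R u v \<Longrightarrow> pres_eq R v u"
  | trans: "pres_eq R u v \<Longrightarrow> pres_eq R v w \<Longrightarrow> pres_eq R u w"
  | cong: "pres_eq R u v \<Longrightarrow> pres_eq R (a @ u @ b) (a @ v @ b)"
  | cancel: "pres_eq R [(g, e), (g, \<not> e)] []"
  | rel: "(u, v) \<in> R \<Longrightarrow> pres_eq R u v"

definition pres_class :: "('g word \<times> 'g word) set \<Rightarrow> 'g word \<Rightarrow> 'g word set" where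
  "pres_class R u = {v. pres_eq R u v}"

definition presented_group :: "('g word \<times> 'g word) set \<Rightarrow> 'g word set monoid" where
  "presented_group R =
     \<lparr>carrier = range (pres_class R),
      monoid.mult = (\<lambda>A B. {w. \<exists>u\<in>A. \<exists>v\<in>B. pres_eq R (u @ v) w}),
      one = pres_class R []\<rparr>"

datatype bs_gen = Gen_x | Gen_t

definition gen_pow :: "'g \<Rightarrow> int \<Rightarrow> 'g word" where
  "gen_pow g k = replicate (nat \<bar>k\<bar>) (g, 0 \<le> k)"

definition BS :: "int \<Rightarrow> int \<Rightarrow> bs_gen word set monoid" where
  "BS k m = presented_group {([(Gen_t, True)] @ gen_pow Gen_x k @ [(Gen_t, False)], gen_pow Gen_x m)}"

lemma pres_class_eq_iff: "pres_class R u = pres_class R v \<longleftrightarrow> pres_eq R u v"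
  unfolding pres_class_def by (auto intro: pres_eq.intros)

lemma pres_eq_append:
  assumes "pres_eq R u u'" "pres_eq R v v'"
  shows "pres_eq R (u @ v) (u' @ v')"
  using pres_eq.cong[OF assms(1), of "[]" v] pres_eq.cong[OF assms(2), of u' "[]"]
  by (auto intro: pres_eq.trans)

lemma presented_group_mult:
  "pres_class R u \<otimes>\<^bsub>presented_group R\<^esub> pres_class R v = pres_class R (u @ v)"
  unfolding presented_group_def pres_class_def
  by (auto intro: pres_eq_append pres_eq.intros dest: pres_eq.trans[OF pres_eq_append])

lemma presented_group_one: "\<one>\<^bsub>presented_group R\<^esub> = pres_class R []"
  by (simp add: presented_group_def)

lemma presented_group_carrier: "carrier (presented_group R) = range (pres_class R)"
  by (simp add: presented_group_def)

definition word_inv :: "'g word \<Rightarrow> 'g word" where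
  "word_inv w = rev (map (\<lambda>(g, e). (g, \<not> e)) w)"

lemma pres_eq_word_inv: "pres_eq R (word_inv w @ w) []"
proof (induction w)
  case Nil
  then show ?case by (simp add: word_inv_def pres_eq.refl)
next
  case (Cons l w)
  obtain g e where l: "l = (g, e)" by (cases l)
  have "pres_eq R (word_inv w @ [(g, \<not> e), (g, e)] @ w) (word_inv w @ [] @ w)"
    using pres_eq.cancel[of R g "\<not> e"] by (intro pres_eq.cong) simp
  with Cons.IH show ?case
    by (auto simp: word_inv_def l intro: pres_eq.trans)
qed

lemma group_presented_group: "group (presented_group R)"
proof (rule groupI)
  fix A assume "A \<in> carrier (presented_group R)"
  then obtain u where "A = pres_class R u" by (auto simp: presented_group_carrier)
  then have "pres_class R (word_inv u) \<otimes>\<^bsub>presented_group R\<^esub> A = \<one>\<^bsub>presented_group R\<^esub>"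
    by (simp add: presented_group_mult presented_group_one pres_class_eq_iff pres_eq_word_inv)
  then show "\<exists>B\<in>carrier (presented_group R). B \<otimes>\<^bsub>presented_group R\<^esub> A = \<one>\<^bsub>presented_group R\<^esub>"
    by (auto simp: presented_group_carrier)
qed (auto simp: presented_group_carrier presented_group_mult presented_group_one)

lemma presented_group_inv:
  "inv\<^bsub>presented_group R\<^esub> (pres_class R u) = pres_class R (word_inv u)"
  by (rule group.inv_equality[OF group_presented_group])
     (auto simp: presented_group_carrier presented_group_mult presented_group_one
        pres_class_eq_iff pres_eq_word_inv)

lemma group_BS: "group (BS k m)"
  unfolding BS_def by (rule group_presented_group)

lemma presented_group_generated:
  "generate (presented_group R) (range (\<lambda>g. pres_class R [(g, True)]))
     = carrier (presented_group R)" (is "generate ?P ?S = _")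
proof
  show "generate ?P ?S \<subseteq> carrier ?P"
    by (rule group.generate_incl[OF group_presented_group]) (auto simp: presented_group_carrier)
  have "pres_class R w \<in> generate ?P ?S" for w
  proof (induction w)
    case Nil
    then show ?case using generate.one[of ?P ?S] by (simp add: presented_group_one)
  next
    case (Cons l w)
    obtain g e where l: "l = (g, e)" by (cases l)
    have pos: "pres_class R [(g, True)] \<in> generate ?P ?S"
      by (rule generate.incl) auto
    have "inv\<^bsub>?P\<^esub> (pres_class R [(g, True)]) \<in> generate ?P ?S"
      by (rule generate.inv) auto
    then have "pres_class R [(g, e)] \<in> generate ?P ?S"
      using pos by (cases e) (auto simp: presented_group_inv word_inv_def)
    from generate.eng[OF this Cons.IH] show ?case by (simp add: presented_group_mult l)
  qed
  then show "carrier ?P \<subseteq> generate ?P ?S" by (auto simp: presented_group_carrier)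
qed

end

theory Submission
  imports Defs
begin

text \<open>
  There is a number \<open>N \<le> 2 ^ 2 ^ (k + 1)\<close> divisible by all positive integers up to \<open>2 ^ k\<close>, a
  product of central binomial coefficients. By Lagrange's theorem \<open>x ^ N\<close> dies in every
  quotient of order at most \<open>2 ^ k\<close>, while the exponential distortion of \<open>x\<close> makes the word length
  of \<open>x ^ N\<close> at most linear in \<open>2 ^ k\<close>. In \<open>BS(1,m)\<close>, expanding \<open>n\<close> in base \<open>m\<close> gives a word of
  length \<open>O(log n)\<close> for \<open>x ^ n\<close>, and the action by affine maps of the line shows that \<open>x\<close> has
  infinite order.
\<close>

section \<open>Numbers with many divisors\<close>

text \<open>Absorption gives
  \<open>i * (p ^ a choose i) = p ^ a * (p ^ a - 1 choose (i - 1))\<close>. If p missed the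
  binomial, all of \<open>p ^ a\<close> would have to divide the smaller positive number i.\<close>

lemma prime_dvd_prime_power_choose:
  fixes p a i :: nat
  assumes "Factorial_Ring.prime p" "0 < i" "i < p ^ a"
  shows "p dvd (p ^ a choose i)"
proof (rule ccontr)
  assume "\<not> p dvd (p ^ a choose i)"
  with \<open>Factorial_Ring.prime p\<close> have "coprime (p ^ a) (p ^ a choose i)"
    by (simp add: prime_imp_coprime)
  moreover have "i * (p ^ a choose i) = p ^ a * (p ^ a - 1 choose (i - 1))"
    using assms by (intro times_binomial_minus1_eq) auto
  ultimately have "p ^ a dvd i"
    by (metis coprime_dvd_mult_left_iff dvd_triv_left)
  with assms show False
    by (auto dest: dvd_imp_le)
qed

text \<open>Apply Vandermonde to 2m = p^a + (2m - p^a). The term i = 0 vanishes because 2m - p^a <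
  m; every other term has 0 < i \<le> m < p^a and falls under the previous lemma.\<close>

lemma prime_dvd_central_binomial:
  fixes p a m :: nat
  assumes "Factorial_Ring.prime p" "m < p ^ a" "p ^ a \<le> 2 * m"
  shows "p dvd (2 * m choose m)"
proof -
  have "2 * m choose m = (p ^ a + (2 * m - p ^ a)) choose m"
    using assms by simp
  also have "\<dots> = (\<Sum>i\<le>m. (p ^ a choose i) * ((2 * m - p ^ a) choose (m - i)))"
    by (rule vandermonde[symmetric])
  also have "p dvd \<dots>"
  proof (rule dvd_sum)
    fix i assume "i \<in> {..m}"
    then show "p dvd (p ^ a choose i) * ((2 * m - p ^ a) choose (m - i))"
      using assms prime_dvd_prime_power_choose[of p i a] by (cases "i = 0") (auto simp: binomial_eq_0)
  qed
  finally show ?thesis .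
qed

text \<open>Substitute for lcm(1, ..., 2^k): a multiple of it whose size needs no estimate on
  primes. Factor i supplies a further p for each power of p in the interval (2^i, 2^(i+1)].\<close>

definition binomial_tower :: "nat \<Rightarrow> nat" where
  "binomial_tower k = (\<Prod>i<k. (2 * 2 ^ i) choose (2 ^ i))"

lemma binomial_tower_pos: "binomial_tower k > 0"
  by (auto simp: binomial_tower_def intro!: prod_pos)

text \<open>Factor i lies in row 2^(i+1) of Pascal's triangle, so it is at most 2^(2^(i+1)); the
  exponents form a geometric sum.\<close>

lemma binomial_tower_le: "binomial_tower k \<le> 2 ^ 2 ^ Suc k"
proof (induction k)
  case (Suc k)
  have "(2 * 2 ^ k choose 2 ^ k) \<le> (2 :: nat) ^ 2 ^ Suc k"
    using binomial_le_pow2[of "2 * 2 ^ k" "2 ^ k"] by simp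
  with Suc have "binomial_tower (Suc k) \<le> 2 ^ 2 ^ Suc k * 2 ^ 2 ^ Suc k"
    by (simp add: binomial_tower_def mult_le_mono)
  also have "\<dots> = 2 ^ 2 ^ Suc (Suc k)"
    by (simp add: power_add[symmetric])
  finally show ?case .
qed (simp add: binomial_tower_def)

text \<open>If p^a first fits under the bound at 2^(k+1), then p^(a-1) is at most half of it and
  already divides the tower of height k; the new central binomial contributes the missing p.\<close>

lemma prime_power_dvd_binomial_tower:
  fixes p a :: nat
  assumes "Factorial_Ring.prime p" "p ^ a \<le> 2 ^ k"
  shows "p ^ a dvd binomial_tower k"
  using assms(2)
proof (induction k arbitrary: a)
  case (Suc k)
  have step: "binomial_tower (Suc k) = binomial_tower k * (2 * 2 ^ k choose 2 ^ k)"
    by (simp add: binomial_tower_def)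
  show ?case
  proof (cases "p ^ a \<le> 2 ^ k")
    case True
    with Suc.IH show ?thesis by (simp add: step)
  next
    case False
    then obtain b where a: "a = Suc b" by (cases a) auto
    have "2 * p ^ b \<le> p ^ a"
      using prime_ge_2_nat[OF \<open>Factorial_Ring.prime p\<close>] by (simp add: a)
    with Suc.prems have "p ^ b \<le> 2 ^ k" by simp
    then have "p ^ b dvd binomial_tower k" by (rule Suc.IH)
    moreover have "p dvd (2 * 2 ^ k choose 2 ^ k)"
      using False Suc.prems by (intro prime_dvd_central_binomial[OF \<open>Factorial_Ring.prime p\<close>, of _ a]) auto
    ultimately have "p ^ b * p dvd binomial_tower (Suc k)"
      unfolding step by (rule mult_dvd_mono)
    then show ?thesis by (simp add: a mult.commute)
  qed
next
  case 0
  then have "a = 0"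
    using one_less_power[OF prime_gt_1_nat[OF \<open>Factorial_Ring.prime p\<close>], of a] by force
  then show ?case by simp
qed

text \<open>Compare multiplicities prime by prime: the full power of p in d is at most d, hence at
  most 2^k.\<close>

lemma dvd_binomial_tower:
  assumes "0 < d" "d \<le> 2 ^ k"
  shows "d dvd binomial_tower k"
proof (rule multiplicity_le_imp_dvd)
  fix p :: nat assume p: "Factorial_Ring.prime p"
  have "p ^ multiplicity p d \<le> d"
    using assms by (intro dvd_imp_le multiplicity_dvd) auto
  then have "p ^ multiplicity p d dvd binomial_tower k"
    using assms p by (intro prime_power_dvd_binomial_tower) auto
  then show "multiplicity p d \<le> multiplicity p (binomial_tower k)"
    using p binomial_tower_pos[of k] by (intro multiplicity_geI) auto
qed (use assms in auto)


section \<open>Word length\<close>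

context group
begin

lemma foldr_mult_closed:
  "set ws \<subseteq> carrier G \<Longrightarrow> foldr (\<lambda>a b. a \<otimes> b) ws \<one> \<in> carrier G"
  by (induction ws) auto

lemma foldr_mult_append:
  assumes "set us \<subseteq> carrier G" "set vs \<subseteq> carrier G"
  shows "foldr (\<lambda>a b. a \<otimes> b) (us @ vs) \<one> =
    foldr (\<lambda>a b. a \<otimes> b) us \<one> \<otimes> foldr (\<lambda>a b. a \<otimes> b) vs \<one>"
  using assms by (induction us) (auto simp: foldr_mult_closed m_assoc)

lemma letters_closed: "S \<subseteq> carrier G \<Longrightarrow> S \<union> m_inv G ` S \<subseteq> carrier G"
  by auto

text \<open>The rules of \<open>generate\<close> invert only elements of S, so every case is a
  letter, the empty word or a concatenation.\<close>

lemma generate_imp_word: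
  assumes "y \<in> generate G S" "S \<subseteq> carrier G"
  shows "\<exists>ws. set ws \<subseteq> S \<union> m_inv G ` S \<and> foldr (\<lambda>a b. a \<otimes> b) ws \<one> = y"
  using assms(1)
proof induction
  case one
  show ?case by (rule exI[of _ "[]"]) simp
next
  case (incl h)
  then show ?case using assms(2) by (intro exI[of _ "[h]"]) auto
next
  case (inv h)
  then show ?case using assms(2) by (intro exI[of _ "[inv h]"]) auto
next
  case (eng h1 h2)
  then obtain us vs where
    "set us \<subseteq> S \<union> m_inv G ` S" "foldr (\<lambda>a b. a \<otimes> b) us \<one> = h1"
    "set vs \<subseteq> S \<union> m_inv G ` S" "foldr (\<lambda>a b. a \<otimes> b) vs \<one> = h2"
    by blast
  moreover from this have "set us \<subseteq> carrier G" "set vs \<subseteq> carrier G"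
    using letters_closed[OF assms(2)] by auto
  ultimately show ?case
    by (intro exI[of _ "us @ vs"]) (simp add: foldr_mult_append del: foldr_append)
qed

lemma word_length_le:
  assumes "set ws \<subseteq> S \<union> m_inv G ` S"
  shows "word_length G S (foldr (\<lambda>a b. a \<otimes> b) ws \<one>) \<le> length ws"
  unfolding word_length_def using assms by (intro Least_le) auto

lemma word_length_letter_le:
  assumes "s \<in> S \<union> m_inv G ` S" "S \<subseteq> carrier G"
  shows "word_length G S s \<le> 1"
  using word_length_le[of "[s]" S] assms by (auto simp: image_iff subset_iff)

lemma word_length_one: "word_length G S \<one> = 0"
  using word_length_le[of "[]" S] by simp

text \<open>The \<open>LEAST\<close> in \<open>word_length\<close> is informative only once some
  word exists; generation provides one, so the minimum is attained.\<close>

lemma geodesic_word: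
  assumes "finitely_generates G S" "y \<in> carrier G"
  obtains ws where "length ws = word_length G S y" "set ws \<subseteq> S \<union> m_inv G ` S"
    "foldr (\<lambda>a b. a \<otimes> b) ws \<one> = y"
proof -
  have "\<exists>n ws. length ws = n \<and> set ws \<subseteq> S \<union> m_inv G ` S \<and> foldr (\<lambda>a b. a \<otimes> b) ws \<one> = y"
    using generate_imp_word[of y S] assms by (auto simp: finitely_generates_def)
  from LeastI_ex[OF this] show thesis
    unfolding word_length_def[symmetric] using that by blast
qed

lemma word_length_mult_le:
  assumes S: "finitely_generates G S" and "a \<in> carrier G" "b \<in> carrier G"
  shows "word_length G S (a \<otimes> b) \<le> word_length G S a + word_length G S b"
proof -
  obtain us where us: "length us = word_length G S a" "set us \<subseteq> S \<union> m_inv G ` S"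
    "foldr (\<lambda>a b. a \<otimes> b) us \<one> = a" using geodesic_word assms by metis
  obtain vs where vs: "length vs = word_length G S b" "set vs \<subseteq> S \<union> m_inv G ` S"
    "foldr (\<lambda>a b. a \<otimes> b) vs \<one> = b" using geodesic_word assms by metis
  have "set us \<subseteq> carrier G" "set vs \<subseteq> carrier G"
    using us vs letters_closed[of S] S by (auto simp: finitely_generates_def)
  then have "foldr (\<lambda>a b. a \<otimes> b) (us @ vs) \<one> = a \<otimes> b"
    using us vs by (simp only: foldr_mult_append)
  with word_length_le[of "us @ vs" S] us vs show ?thesis by simp
qed

text \<open>Rewrite a geodesic S-word letter by letter, with L bounding the S'-length of the
  finitely many letters. This allows distortion and residual finiteness growth to be measured in
  different generating sets.\<close>

lemma word_length_change_generators:
  assumes S: "finitely_generates G S" and S': "finitely_generates G S'"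
  obtains L where "\<And>y. y \<in> carrier G \<Longrightarrow> word_length G S' y \<le> L * word_length G S y"
proof -
  have "finite (word_length G S' ` (S \<union> m_inv G ` S))"
    using S by (simp add: finitely_generates_def)
  then obtain L where L: "\<And>s. s \<in> S \<union> m_inv G ` S \<Longrightarrow> word_length G S' s \<le> L"
    unfolding finite_nat_set_iff_bounded_le by blast
  have carr: "S \<union> m_inv G ` S \<subseteq> carrier G"
    using S letters_closed by (auto simp: finitely_generates_def)
  have word: "word_length G S' (foldr (\<lambda>a b. a \<otimes> b) ws \<one>) \<le> L * length ws"
    if "set ws \<subseteq> S \<union> m_inv G ` S" for ws
    using that
  proof (induction ws)
    case (Cons s ws)
    have "foldr (\<lambda>a b. a \<otimes> b) ws \<one> \<in> carrier G" "s \<in> carrier G"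
      using Cons.prems carr by (auto intro!: foldr_mult_closed)
    then have "word_length G S' (foldr (\<lambda>a b. a \<otimes> b) (s # ws) \<one>) \<le>
        word_length G S' s + word_length G S' (foldr (\<lambda>a b. a \<otimes> b) ws \<one>)"
      using word_length_mult_le[OF S'] by simp
    also have "\<dots> \<le> L + L * length ws"
      using Cons L[of s] by (intro add_mono) auto
    finally show ?case by simp
  qed (simp add: word_length_one)
  show thesis
  proof
    fix y assume "y \<in> carrier G"
    with geodesic_word[OF S] word show "word_length G S' y \<le> L * word_length G S y" by metis
  qed
qed


section \<open>Exponential distortion forces linear residual finiteness growth\<close>

text \<open>By Lagrange, the order of a quotient with at most r elements divides N, so the image of
  \<open>x [^] N\<close> is trivial there. If no finite quotient detects the element, the infimum is
  \<infinity> and the bound still holds.\<close>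

lemma detect_order_gt:
  assumes x: "x \<in> carrier G" and N: "\<And>d. 0 < d \<Longrightarrow> d \<le> r \<Longrightarrow> d dvd N"
  shows "enat r < detect_order G (x [^] N)"
proof -
  have "r < order H" if H: "group H" "finite (carrier H)" and \<phi>: "\<phi> \<in> epi G H"
    and ne: "\<phi> (x [^] N) \<noteq> \<one>\<^bsub>H\<^esub>" for H :: "nat monoid" and \<phi>
  proof (rule ccontr)
    assume "\<not> r < order H"
    moreover have "0 < order H"
      using H by (simp add: group.is_monoid monoid.order_gt_0_iff_finite)
    ultimately have "order H dvd N" using N by simp
    then obtain q where q: "N = order H * q" ..
    have hom: "\<phi> \<in> hom G H" using \<phi> by (simp add: epi_def)
    then have y: "\<phi> x \<in> carrier H" using x by (rule hom_in_carrier)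
    have "\<phi> (x [^] N) = \<phi> x [^]\<^bsub>H\<^esub> N"
      using hom_nat_pow[OF hom x] H by simp
    also have "\<dots> = \<one>\<^bsub>H\<^esub>"
      using y H by (simp add: q group.pow_order_eq_1 group.is_monoid monoid.nat_pow_one
          monoid.nat_pow_pow[symmetric])
    finally show False using ne by simp
  qed
  \<comment> \<open>An infimum preserves only weak bounds, so strictness is carried by the
    successor.\<close>
  then have "enat (Suc r) \<le> detect_order G (x [^] N)"
    unfolding detect_order_def by (intro Inf_greatest) (auto simp: Suc_le_eq)
  then show ?thesis by (simp add: Suc_ile_eq)
qed

text \<open>The premise \<open>distorted\<close> says that x^n has length O(log n), with a power 2^j
  \<ge> n in place of a real logarithm. Both halves of the theorem enter through it.\<close>

proposition linear_growth_le_RF: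
  assumes S: "finitely_generates G S" and S': "finitely_generates G S'"
    and x: "x \<in> carrier G" "ord x = 0"
    and distorted: "\<And>(n::nat) j. 0 < n \<Longrightarrow> n \<le> 2 ^ j \<Longrightarrow> word_length G S (x [^] n) \<le> A * (j + 1)"
  shows "growth_le enat (RF G S')"
proof -
  obtain L where L: "\<And>y. y \<in> carrier G \<Longrightarrow> word_length G S' y \<le> L * word_length G S y"
    using word_length_change_generators[OF S S'] by blast
  \<comment> \<open>The product bounds the S'-length of the witness per unit of n; the summand 2
    pays for rounding n down to a power of two and keeps C positive.\<close>
  define C where "C = L * A * 3 + 2"
  have "enat n \<le> enat C * RF G S' (C * n)" if n: "n > 0" for n :: nat
  proof -
    obtain k where k: "2 ^ k \<le> n" "n < 2 ^ Suc k"
      using ex_power_ivl1[of 2 n] n by auto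
    define y where "y = x [^] binomial_tower k"
    have y: "y \<in> carrier G" using x by (simp add: y_def)
    \<comment> \<open>As \<open>ord x = 0\<close>, a power of x is trivial only if 0 divides its
      exponent, and the tower is positive.\<close>
    have "y \<noteq> \<one>"
      using x binomial_tower_pos[of k] pow_eq_id[of x "binomial_tower k"] by (simp add: y_def)
    \<comment> \<open>Here j is 2^(k+1): distortion turns a doubly exponential exponent into a
      length linear in 2^k.\<close>
    have "word_length G S y \<le> A * (2 ^ Suc k + 1)"
      unfolding y_def by (rule distorted[OF binomial_tower_pos binomial_tower_le])
    also have "\<dots> \<le> A * (3 * n)"
      using k n by (intro mult_le_mono) auto
    finally have length_y: "word_length G S y \<le> A * (3 * n)" .
    have "word_length G S' y \<le> L * word_length G S y" by (rule L[OF y])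
    also have "\<dots> \<le> L * (A * (3 * n))" using length_y by (rule mult_le_mono2)
    also have "\<dots> \<le> C * n" by (simp add: C_def algebra_simps)
    finally have "word_length G S' y \<le> C * n" .
    with y \<open>y \<noteq> \<one>\<close> have "detect_order G y \<le> RF G S' (C * n)"
      unfolding RF_def by (intro Sup_upper) blast
    moreover have "enat (2 ^ k) \<le> detect_order G y"
      unfolding y_def using x dvd_binomial_tower by (intro less_imp_le detect_order_gt) auto
    ultimately have RF: "enat (2 ^ k) \<le> RF G S' (C * n)" by (rule order.trans[rotated])
    have "n \<le> C * 2 ^ k"
      using k by (simp add: C_def algebra_simps)
    then have "enat n \<le> enat C * enat (2 ^ k)" by simp
    also have "\<dots> \<le> enat C * RF G S' (C * n)"
      using RF by (rule mult_left_mono) simp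
    finally show ?thesis .
  qed
  moreover have "C > 0" by (simp add: C_def)
  ultimately show ?thesis unfolding growth_le_def by blast
qed

text \<open>Take base-2 logarithms in the upper distortion bound: c with C < 2^c absorbs the
  constant, and c + j is at most (c + 1)(j + 1).\<close>

lemma strictly_exp_distorted_word_length_le:
  assumes "strictly_exp_distorted G S x"
  obtains A where
    "\<And>(n::nat) j. 0 < n \<Longrightarrow> n \<le> 2 ^ j \<Longrightarrow> word_length G S (x [^] n) \<le> A * (j + 1)"
proof -
  obtain C :: real where C:
    "\<And>n::nat. 0 < n \<Longrightarrow> 2 ^ word_length G S (x [^] n) \<le> C * real n"
    using assms unfolding strictly_exp_distorted_def by blast
  obtain c where c: "C < 2 ^ c"
    using real_arch_pow[of 2 C] by auto
  show thesis
  proof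
    fix n j :: nat assume n: "0 < n" "n \<le> 2 ^ j"
    have "(2::real) ^ word_length G S (x [^] n) \<le> C * real n"
      using C n by simp
    also have "\<dots> \<le> 2 ^ c * 2 ^ j"
    proof (intro mult_mono)
      show "real n \<le> 2 ^ j" using n by (metis of_nat_le_iff of_nat_numeral of_nat_power)
    qed (use c in auto)
    finally have "(2::real) ^ word_length G S (x [^] n) \<le> 2 ^ (c + j)"
      by (simp add: power_add)
    then have "word_length G S (x [^] n) \<le> c + j" by simp
    also have "\<dots> \<le> (c + 1) * (j + 1)" by simp
    finally show "word_length G S (x [^] n) \<le> (c + 1) * (j + 1)" .
  qed
qed

end


section \<open>Baumslag--Solitar groups\<close>

fun affine_letter :: "int \<Rightarrow> bs_gen \<times> bool \<Rightarrow> real \<Rightarrow> real" where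
  "affine_letter m (Gen_x, e) r = (if e then r + 1 else r - 1)"
| "affine_letter m (Gen_t, e) r = (if e then of_int m * r else r / of_int m)"

text \<open>The rightmost letter acts first, so concatenation of words becomes composition of
  maps.\<close>

definition affine_word :: "int \<Rightarrow> bs_gen word \<Rightarrow> real \<Rightarrow> real" where
  "affine_word m w = foldr (affine_letter m) w"

lemma affine_word_append: "affine_word m (u @ v) r = affine_word m u (affine_word m v r)"
  by (simp add: affine_word_def)

lemma affine_word_replicate_x: "affine_word m (replicate n (Gen_x, True)) r = r + real n"
  by (induction n) (auto simp: affine_word_def)

definition BS1_relation :: "int \<Rightarrow> (bs_gen word \<times> bs_gen word) set" where
  "BS1_relation m =
    {([(Gen_t, True)] @ gen_pow Gen_x 1 @ [(Gen_t, False)], gen_pow Gen_x m)}"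

lemma BS_1_eq: "BS 1 m = presented_group (BS1_relation m)"
  unfolding BS_def BS1_relation_def ..

text \<open>The action descends to the group: free cancellation holds because dilation by m > 0 is
  invertible, and the relation because m(r/m + 1) = r + m.\<close>

lemma affine_word_pres_eq:
  assumes "pres_eq (BS1_relation m) u v" and m: "m > 0"
  shows "affine_word m u = affine_word m v"
  using assms(1)
proof induction
  case (cong u v a b)
  then show ?case by (auto simp: affine_word_append)
next
  case (cancel g e)
  show ?case using m by (cases g; cases e) (auto simp: affine_word_def)
next
  case (rel u v)
  then have "u = [(Gen_t, True)] @ gen_pow Gen_x 1 @ [(Gen_t, False)]" "v = gen_pow Gen_x m"
    by (auto simp: BS1_relation_def)
  then show ?case
    using m by (auto simp: affine_word_append affine_word_replicate_x gen_pow_def)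
      (auto simp: affine_word_def algebra_simps)
qed auto

section \<open>Canonical generators and the infinite order of x\<close>

abbreviation BS_x :: "int \<Rightarrow> bs_gen word set" where
  "BS_x m \<equiv> pres_class (BS1_relation m) [(Gen_x, True)]"

abbreviation BS_t :: "int \<Rightarrow> bs_gen word set" where
  "BS_t m \<equiv> pres_class (BS1_relation m) [(Gen_t, True)]"

lemma BS_carrier: "pres_class (BS1_relation m) u \<in> carrier (BS 1 m)"
  by (simp add: BS_1_eq presented_group_carrier)

lemma BS_mult: "pres_class (BS1_relation m) u \<otimes>\<^bsub>BS 1 m\<^esub> pres_class (BS1_relation m) v =
    pres_class (BS1_relation m) (u @ v)"
  unfolding BS_1_eq by (rule presented_group_mult)

lemma BS_one: "\<one>\<^bsub>BS 1 m\<^esub> = pres_class (BS1_relation m) []"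
  unfolding BS_1_eq by (rule presented_group_one)

lemma BS_x_pow:
  "BS_x m [^]\<^bsub>BS 1 m\<^esub> n = pres_class (BS1_relation m) (replicate n (Gen_x, True))"
  by (induction n) (simp_all add: nat_pow_0 nat_pow_Suc BS_one BS_mult replicate_append_same)

lemma ord_BS_x:
  assumes "m > 0"
  shows "group.ord (BS 1 m) (BS_x m) = 0"
proof -
  interpret group "BS 1 m" by (rule group_BS)
  have "n = 0" if "BS_x m [^]\<^bsub>BS 1 m\<^esub> n = \<one>\<^bsub>BS 1 m\<^esub>" for n :: nat
  proof -
    have "pres_eq (BS1_relation m) (replicate n (Gen_x, True)) []"
      using that unfolding BS_x_pow BS_one pres_class_eq_iff .
    \<comment> \<open>The translation x^n sends 0 to n, while the empty word fixes 0.\<close>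
    then have "affine_word m (replicate n (Gen_x, True)) 0 = affine_word m [] 0"
      using affine_word_pres_eq assms by metis
    then show "n = 0" unfolding affine_word_replicate_x by (simp add: affine_word_def)
  qed
  then show ?thesis using pow_ord_eq_1 BS_carrier by blast
qed

lemma BS_finitely_generates: "finitely_generates (BS 1 m) {BS_x m, BS_t m}"
proof -
  have UNIV: "(UNIV :: bs_gen set) = {Gen_x, Gen_t}"
    using bs_gen.exhaust by blast
  have "range (\<lambda>g. pres_class (BS1_relation m) [(g, True)]) = {BS_x m, BS_t m}"
    unfolding UNIV by simp
  with presented_group_generated[of "BS1_relation m"] show ?thesis
    by (simp add: finitely_generates_def BS_carrier) (simp add: BS_1_eq)
qed

section \<open>Logarithmic word length of the powers of x\<close>

lemma BS_t_conj_pow: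
  assumes "m > 0"
  shows "BS_t m \<otimes>\<^bsub>BS 1 m\<^esub> (BS_x m [^]\<^bsub>BS 1 m\<^esub> n) \<otimes>\<^bsub>BS 1 m\<^esub> inv\<^bsub>BS 1 m\<^esub> (BS_t m)
    = BS_x m [^]\<^bsub>BS 1 m\<^esub> (nat m * n)"
proof -
  interpret group "BS 1 m" by (rule group_BS)
  let ?x = "BS_x m" and ?t = "BS_t m"
  have carr: "?x \<in> carrier (BS 1 m)" "?t \<in> carrier (BS 1 m)" by (rule BS_carrier)+
  have "inv\<^bsub>BS 1 m\<^esub> ?t = pres_class (BS1_relation m) [(Gen_t, False)]"
    unfolding BS_1_eq presented_group_inv by (simp add: word_inv_def)
  moreover have "pres_eq (BS1_relation m) [(Gen_t, True), (Gen_x, True), (Gen_t, False)]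
      (replicate (nat m) (Gen_x, True))"
    by (rule pres_eq.rel) (use assms in \<open>simp add: BS1_relation_def gen_pow_def\<close>)
  \<comment> \<open>This is the defining relation; higher powers follow since conjugation by t is
    multiplicative.\<close>
  ultimately have base: "?t \<otimes>\<^bsub>BS 1 m\<^esub> ?x \<otimes>\<^bsub>BS 1 m\<^esub> inv\<^bsub>BS 1 m\<^esub> ?t = ?x [^]\<^bsub>BS 1 m\<^esub> nat m"
    unfolding BS_x_pow by (simp add: BS_mult pres_class_eq_iff)
  show ?thesis
  proof (induction n)
    case 0
    show ?case using carr by simp
  next
    case (Suc n)
    have "?t \<otimes>\<^bsub>BS 1 m\<^esub> (?x [^]\<^bsub>BS 1 m\<^esub> Suc n) \<otimes>\<^bsub>BS 1 m\<^esub> inv\<^bsub>BS 1 m\<^esub> ?t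
      = (?t \<otimes>\<^bsub>BS 1 m\<^esub> (?x [^]\<^bsub>BS 1 m\<^esub> n) \<otimes>\<^bsub>BS 1 m\<^esub> inv\<^bsub>BS 1 m\<^esub> ?t) \<otimes>\<^bsub>BS 1 m\<^esub>
        (?t \<otimes>\<^bsub>BS 1 m\<^esub> ?x \<otimes>\<^bsub>BS 1 m\<^esub> inv\<^bsub>BS 1 m\<^esub> ?t)"
      using carr by (simp add: m_assoc inv_solve_left)
    also have "\<dots> = ?x [^]\<^bsub>BS 1 m\<^esub> (nat m * Suc n)"
      unfolding Suc.IH base using carr by (simp add: nat_pow_mult add.commute)
    finally show ?case .
  qed
qed

text \<open>Horner's scheme in base m: for n = mq + a, x^n = t x^q t^(-1) x^a. Each of the j digits
  costs the two letters t and t^(-1) and fewer than m letters x.\<close>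

lemma word_length_BS_x_pow:
  assumes m: "m > 1" and "n < nat m ^ j"
  shows "word_length (BS 1 m) {BS_x m, BS_t m} (BS_x m [^]\<^bsub>BS 1 m\<^esub> n) \<le> (nat m + 2) * j"
proof -
  interpret group "BS 1 m" by (rule group_BS)
  let ?x = "BS_x m" and ?t = "BS_t m" and ?len = "word_length (BS 1 m) {BS_x m, BS_t m}"
  note triangle = word_length_mult_le[OF BS_finitely_generates[of m]]
  have carr: "?x \<in> carrier (BS 1 m)" "?t \<in> carrier (BS 1 m)" by (rule BS_carrier)+
  show ?thesis
    using assms(2)
  proof (induction j arbitrary: n)
    case 0
    then show ?case by (simp add: word_length_one)
  next
    case (Suc j)
    define q a where "q = n div nat m" and "a = n mod nat m"
    have "q < nat m ^ j"
      using Suc.prems m by (simp add: q_def less_mult_imp_div_less mult.commute)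
    then have IH: "?len (?x [^]\<^bsub>BS 1 m\<^esub> q) \<le> (nat m + 2) * j" by (rule Suc.IH)
    have "a < nat m" using m by (simp add: a_def)
    have pow: "?len (?x [^]\<^bsub>BS 1 m\<^esub> i) \<le> i" for i :: nat
    proof (induction i)
      case (Suc i)
      have "?len ?x \<le> 1" using carr by (intro word_length_letter_le) auto
      with Suc triangle[of "?x [^]\<^bsub>BS 1 m\<^esub> i" ?x] carr show ?case by simp
    qed (simp add: word_length_one)
    have t: "?len ?t \<le> 1" "?len (inv\<^bsub>BS 1 m\<^esub> ?t) \<le> 1"
      using carr by (intro word_length_letter_le; auto)+
    have "?x [^]\<^bsub>BS 1 m\<^esub> n = ?x [^]\<^bsub>BS 1 m\<^esub> (nat m * q + a)"
      by (simp add: q_def a_def)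
    also have "\<dots> = ?t \<otimes>\<^bsub>BS 1 m\<^esub> (?x [^]\<^bsub>BS 1 m\<^esub> q) \<otimes>\<^bsub>BS 1 m\<^esub> inv\<^bsub>BS 1 m\<^esub> ?t
        \<otimes>\<^bsub>BS 1 m\<^esub> (?x [^]\<^bsub>BS 1 m\<^esub> a)"
      using m carr by (simp add: BS_t_conj_pow nat_pow_mult)
    finally have "?len (?x [^]\<^bsub>BS 1 m\<^esub> n) =
        ?len (?t \<otimes>\<^bsub>BS 1 m\<^esub> (?x [^]\<^bsub>BS 1 m\<^esub> q) \<otimes>\<^bsub>BS 1 m\<^esub> inv\<^bsub>BS 1 m\<^esub> ?t
        \<otimes>\<^bsub>BS 1 m\<^esub> (?x [^]\<^bsub>BS 1 m\<^esub> a))"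
      by (rule arg_cong)
    also have "\<dots> \<le> ?len ?t + ?len (?x [^]\<^bsub>BS 1 m\<^esub> q) +
        ?len (inv\<^bsub>BS 1 m\<^esub> ?t) + ?len (?x [^]\<^bsub>BS 1 m\<^esub> a)"
      using triangle[of "?t \<otimes>\<^bsub>BS 1 m\<^esub> (?x [^]\<^bsub>BS 1 m\<^esub> q) \<otimes>\<^bsub>BS 1 m\<^esub> inv\<^bsub>BS 1 m\<^esub> ?t"
          "?x [^]\<^bsub>BS 1 m\<^esub> a"]
        triangle[of "?t \<otimes>\<^bsub>BS 1 m\<^esub> (?x [^]\<^bsub>BS 1 m\<^esub> q)" "inv\<^bsub>BS 1 m\<^esub> ?t"]
        triangle[of ?t "?x [^]\<^bsub>BS 1 m\<^esub> q"] carr by simp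
    also have "\<dots> \<le> 1 + (nat m + 2) * j + 1 + nat m"
      using t IH pow[of a] \<open>a < nat m\<close> by linarith
    finally show ?case by simp
  qed
qed

theorem linear_growth_le_RF_BS:
  assumes m: "m > 1" and S: "finitely_generates (BS 1 m) S"
  shows "growth_le enat (RF (BS 1 m) S)"
proof (rule group.linear_growth_le_RF[OF group_BS BS_finitely_generates S BS_carrier ord_BS_x])
  fix n j :: nat assume "0 < n" "n \<le> 2 ^ j"
  \<comment> \<open>The digit count requires a strict bound, hence j + 1 digits; 2 \<le> m then
    allows passing to base m.\<close>
  have "n < (2::nat) ^ Suc j" using \<open>n \<le> 2 ^ j\<close> by (simp add: le_less_trans)
  also have "\<dots> \<le> nat m ^ Suc j" using m by (intro power_mono) auto
  finally have "n < nat m ^ Suc j" .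
  from word_length_BS_x_pow[OF m this]
  show "word_length (BS 1 m) {BS_x m, BS_t m} (BS_x m [^]\<^bsub>BS 1 m\<^esub> n)
      \<le> (nat m + 2) * (j + 1)"
    by simp
qed (use m in simp)

theorem corollary1p5:
  shows "(\<forall>(G :: ('a, 'b) monoid_scheme) S S' x.
            metabelian G \<and> finitely_generates G S \<and> finitely_generates G S' \<and>
            x \<in> Fitt G \<and> x \<noteq> \<one>\<^bsub>G\<^esub> \<and> strictly_exp_distorted G S x
            \<longrightarrow> growth_le enat (RF G S'))
       \<and> (\<forall>(m::int) S. m > 1 \<and> finitely_generates (BS 1 m) S
            \<longrightarrow> growth_le enat (RF (BS 1 m) S))"
proof (intro conjI allI impI; elim conjE)
  fix G :: "('a, 'b) monoid_scheme" and S S' x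
  assume "metabelian G" and S: "finitely_generates G S" "finitely_generates G S'"
    and x: "strictly_exp_distorted G S x"
  then interpret group G by (simp add: metabelian_def)
  \<comment> \<open>The real distortion constants become one natural number A, as the premise
    \<open>distorted\<close> requires.\<close>
  obtain A where
    "\<And>(n::nat) j. 0 < n \<Longrightarrow> n \<le> 2 ^ j \<Longrightarrow> word_length G S (x [^]\<^bsub>G\<^esub> n) \<le> A * (j + 1)"
    using strictly_exp_distorted_word_length_le[OF x] by blast
  with S x show "growth_le enat (RF G S')"
    by (intro linear_growth_le_RF[of S S' x A]) (auto simp: strictly_exp_distorted_def)
next
  fix m :: int and S
  assume "m > 1" "finitely_generates (BS 1 m) S"
  then show "growth_le enat (RF (BS 1 m) S)" by (rule linear_growth_le_RF_BS)
qed

end
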